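(* There exists a real constant $C_0$ such that for every positive integer $a$ with $l(a)\ge 1$, $$\|\mu_a\|_{l^2(\mathbb{Z})}\le C_0\, l(a)^{-1/4}.$$
   Context: For $x\in\mathbb{N}$, $s_2(x)$ is the number of digits $1$ in the binary expansion of $x$. For $a\in\mathbb{N}$ and $d\in\mathbb{Z}$, $\mu_a(d)=\lim_{N\to\infty}\frac1N\#\{x\in\mathbb{N}: x\le N,\ s_2(x+a)-s_2(x)=d\}$ (this limit exists), a probability measure on $\mathbb{Z}$. Writing $a=\sum_{k=0}^N a_k2^k$ with $a_N=1$, $\underline a$ denotes the word $a_0a_1\cdots a_N$ (least significant digit first), and $l(a)$ is the number of occurrences of the subword $01$ in $\underline a$, i.e. the number of indices $i$ with $a_i=0$, $a_{i+1}=1$. *)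

theory Defs
  imports "HOL-Analysis.Analysis"
begin

definition s2 :: "nat \<Rightarrow> nat"
  where "s2 x = card {i. bit x i}"

definition mu :: "nat \<Rightarrow> int \<Rightarrow> real"
  where "mu a d =
    lim (\<lambda>N. real (card {x. x \<le> N \<and> int (s2 (x + a)) - int (s2 x) = d}) / real N)"

text \<open>
  With the least significant digit first, an occurrence of \<open>01\<close> at position \<open>i\<close> is a digit 0
  at \<open>i\<close> followed by a digit 1 at \<open>i + 1\<close>. The latter forces \<open>i + 1\<close> to be at most the index of
  the leading digit, so the indices need no explicit upper bound.
\<close>

definition l :: "nat \<Rightarrow> nat"
  where "l a = card {i. \<not> bit a i \<and> bit a (i + 1)}"

text \<open>
  \<^const>\<open>infsum\<close> is 0 on non-summable families, so this is the norm on square-summable functions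
  only; the lemma \<open>mu_square_summable\<close> below shows that \<^const>\<open>mu\<close> is one.
\<close>

definition l2_norm :: "(int \<Rightarrow> real) \<Rightarrow> real"
  where "l2_norm f = sqrt (\<Sum>\<^sub>\<infinity>d\<in>UNIV. (f d)\<^sup>2)"


lemma finite_bits: "finite {i. bit (x::nat) i}"
proof (rule finite_subset)
  show "{i. bit x i} \<subseteq> {..<x}"
  proof
    fix i assume "i \<in> {i. bit x i}"
    then have "x div 2 ^ i \<noteq> 0" by (metis bit_iff_odd even_zero mem_Collect_eq)
    then have "2 ^ i \<le> x" by (meson div_less not_less)
    then have "i < x" using less_exp[of i] by (rule less_le_trans[rotated])
    then show "i \<in> {..<x}" by simp
  qed
qed simp

lemma s2_0 [simp]: "s2 0 = 0"
  by (simp add: s2_def)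

lemma s2_double [simp]: "s2 (2 * x) = s2 x"
proof -
  have "{i. bit (2 * x) i} = Suc ` {i. bit x i}"
  proof (intro set_eqI)
    fix i show "i \<in> {i. bit (2 * x) i} \<longleftrightarrow> i \<in> Suc ` {i. bit x i}"
      by (cases i) (auto simp: bit_Suc bit_0)
  qed
  then show ?thesis by (simp add: s2_def card_image)
qed

lemma s2_double_Suc [simp]: "s2 (Suc (2 * x)) = Suc (s2 x)"
proof -
  have "{i. bit (Suc (2 * x)) i} = insert 0 (Suc ` {i. bit x i})"
  proof (intro set_eqI)
    fix i show "i \<in> {i. bit (Suc (2 * x)) i} \<longleftrightarrow> i \<in> insert 0 (Suc ` {i. bit x i})"
      by (cases i) (auto simp: bit_Suc bit_0)
  qed
  then show ?thesis by (simp add: s2_def card_image finite_bits)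
qed

lemma s2_Suc_le: "s2 (Suc x) \<le> Suc (s2 x)"
proof (induction x rule: less_induct)
  case (less x)
  show ?case
  proof (cases "even x")
    case True
    then obtain y where "x = 2 * y" by blast
    then show ?thesis by simp
  next
    case False
    then obtain y where y: "x = Suc (2 * y)" by (metis oddE Suc_eq_plus1)
    then have "s2 (Suc y) \<le> Suc (s2 y)" using less by simp
    moreover have "s2 (Suc x) = s2 (Suc y)" using s2_double[of "Suc y"] y by simp
    ultimately show ?thesis using y by simp
  qed
qed

definition has_density :: "nat set \<Rightarrow> real \<Rightarrow> bool"
  where "has_density S L \<longleftrightarrow> (\<lambda>N. real (card {x. x \<le> N \<and> x \<in> S}) / real N) \<longlonglongrightarrow> L"

definition diff_set :: "nat \<Rightarrow> int \<Rightarrow> nat set"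
  where "diff_set a d = {x. int (s2 (x + a)) - int (s2 x) = d}"

lemma has_density_split:
  assumes E: "has_density {x. 2 * x \<in> S} L1" and O: "has_density {x. Suc (2 * x) \<in> S} L2"
  shows "has_density S ((L1 + L2) / 2)"
proof -
  let ?e = "\<lambda>N. real (card {x. x \<le> N \<and> 2 * x \<in> S})"
  let ?o = "\<lambda>N. real (card {x. x \<le> N \<and> Suc (2 * x) \<in> S})"
  have split: "real (card {x. x \<le> N \<and> x \<in> S}) = ?e (N div 2) + ?o ((N - 1) div 2)" if "N \<ge> 1" for N
  proof -
    let ?A = "{x. x \<le> N div 2 \<and> 2 * x \<in> S}" and ?B = "{x. x \<le> (N - 1) div 2 \<and> Suc (2 * x) \<in> S}"
    have "{x. x \<le> N \<and> x \<in> S} = (\<lambda>x. 2 * x) ` ?A \<union> (\<lambda>x. Suc (2 * x)) ` ?B" (is "?L = ?R")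
    proof (intro set_eqI)
      fix x show "x \<in> ?L \<longleftrightarrow> x \<in> ?R"
      proof (cases "even x")
        case True
        then obtain y where "x = 2 * y" by blast
        moreover have "2 * y \<noteq> Suc (2 * z)" for z by presburger
        ultimately show ?thesis by auto
      next
        case False
        then obtain y where y: "x = Suc (2 * y)" by (metis oddE Suc_eq_plus1)
        have "Suc (2 * y) \<noteq> 2 * z" for z by presburger
        moreover have "Suc (2 * y) \<le> N \<longleftrightarrow> y \<le> (N - 1) div 2" using that by presburger
        ultimately show ?thesis using y by auto
      qed
    qed
    moreover have "(\<lambda>x. 2 * x) ` ?A \<inter> (\<lambda>x. Suc (2 * x)) ` ?B = {}"
      by auto presburger
    moreover have "card ((\<lambda>x. 2 * x) ` ?A) = card ?A" by (rule card_image) (auto simp: inj_on_def)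
    moreover have "card ((\<lambda>x. Suc (2 * x)) ` ?B) = card ?B" by (rule card_image) (auto simp: inj_on_def)
    ultimately show ?thesis by (simp add: card_Un_disjoint)
  qed
  have half: "(\<lambda>N. real (N div 2) / real N) \<longlonglongrightarrow> 1/2"
    and half': "(\<lambda>N. real ((N - 1) div 2) / real N) \<longlonglongrightarrow> 1/2"
  proof -
    have t: "(\<lambda>N. 1/2 - 1 / real N) \<longlonglongrightarrow> 1/2 - 0"
      by (intro tendsto_intros lim_1_over_n)
    have "\<forall>\<^sub>F N in sequentially. 1/2 - 1 / real N \<le> real (N div 2) / real N"
      using eventually_ge_at_top[of 1]
    proof eventually_elim
      case (elim N)
      have "N \<le> 2 * (N div 2) + 2" by presburger
      then have "real N \<le> 2 * real (N div 2) + 2" by linarith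
      then have "(real N - 2) / 2 \<le> real (N div 2)" by (simp add: field_simps)
      then have "(real N - 2) / 2 / real N \<le> real (N div 2) / real N" by (rule divide_right_mono) simp
      moreover have "(real N - 2) / 2 / real N = 1/2 - 1 / real N" using elim by (simp add: field_simps)
      ultimately show ?case by simp
    qed
    moreover have "\<forall>\<^sub>F N in sequentially. real (N div 2) / real N \<le> 1/2"
      using eventually_ge_at_top[of 1]
    proof eventually_elim
      case (elim N)
      have "2 * (N div 2) \<le> N" by presburger
      then have "2 * real (N div 2) \<le> real N" by linarith
      then show ?case using elim by (simp add: field_simps)
    qed
    ultimately show "(\<lambda>N. real (N div 2) / real N) \<longlonglongrightarrow> 1/2"
      using tendsto_sandwich[OF _ _ _ tendsto_const] t by fastforce
    have "\<forall>\<^sub>F N in sequentially. 1/2 - 1 / real N \<le> real ((N - 1) div 2) / real N"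
      using eventually_ge_at_top[of 1]
    proof eventually_elim
      case (elim N)
      have "N \<le> 2 * ((N - 1) div 2) + 2" by presburger
      then have "real N \<le> 2 * real ((N - 1) div 2) + 2" by linarith
      then have "(real N - 2) / 2 \<le> real ((N - 1) div 2)" by (simp add: field_simps)
      then have "(real N - 2) / 2 / real N \<le> real ((N - 1) div 2) / real N" by (rule divide_right_mono) simp
      moreover have "(real N - 2) / 2 / real N = 1/2 - 1 / real N" using elim by (simp add: field_simps)
      ultimately show ?case by simp
    qed
    moreover have "\<forall>\<^sub>F N in sequentially. real ((N - 1) div 2) / real N \<le> 1/2"
      using eventually_ge_at_top[of 1]
    proof eventually_elim
      case (elim N)
      have "2 * ((N - 1) div 2) \<le> N" by presburger
      then have "2 * real ((N - 1) div 2) \<le> real N" by linarith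
      then show ?case using elim by (simp add: field_simps)
    qed
    ultimately show "(\<lambda>N. real ((N - 1) div 2) / real N) \<longlonglongrightarrow> 1/2"
      using tendsto_sandwich[OF _ _ _ tendsto_const] t by fastforce
  qed
  have f: "filterlim (\<lambda>N::nat. N div 2) at_top at_top"
    "filterlim (\<lambda>N::nat. (N - 1) div 2) at_top at_top"
  proof -
    show "filterlim (\<lambda>N::nat. N div 2) at_top at_top"
      unfolding filterlim_at_top
    proof
      fix Z :: nat
      show "\<forall>\<^sub>F N in at_top. Z \<le> N div 2"
        using eventually_ge_at_top[of "2 * Z"] by eventually_elim presburger
    qed
    show "filterlim (\<lambda>N::nat. (N - 1) div 2) at_top at_top"
      unfolding filterlim_at_top
    proof
      fix Z :: nat
      show "\<forall>\<^sub>F N in at_top. Z \<le> (N - 1) div 2"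
        using eventually_ge_at_top[of "2 * Z + 1"] by eventually_elim presburger
    qed
  qed
  have e: "(\<lambda>N. ?e (N div 2) / real (N div 2)) \<longlonglongrightarrow> L1"
    using filterlim_compose[OF E[unfolded has_density_def] f(1)] by simp
  have o: "(\<lambda>N. ?o ((N - 1) div 2) / real ((N - 1) div 2)) \<longlonglongrightarrow> L2"
    using filterlim_compose[OF O[unfolded has_density_def] f(2)] by simp
  have "(\<lambda>N. ?e (N div 2) / real (N div 2) * (real (N div 2) / real N)
      + ?o ((N - 1) div 2) / real ((N - 1) div 2) * (real ((N - 1) div 2) / real N))
      \<longlonglongrightarrow> L1 * (1/2) + L2 * (1/2)"
    by (intro tendsto_add tendsto_mult e o half half')
  moreover have "\<forall>\<^sub>F N in sequentially.
      ?e (N div 2) / real (N div 2) * (real (N div 2) / real N)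
      + ?o ((N - 1) div 2) / real ((N - 1) div 2) * (real ((N - 1) div 2) / real N)
      = real (card {x. x \<le> N \<and> x \<in> S}) / real N"
    using eventually_ge_at_top[of 3]
  proof eventually_elim
    case (elim N)
    have "N div 2 \<noteq> 0" "(N - 1) div 2 \<noteq> 0" using elim by presburger+
    then have "real (N div 2) \<noteq> 0" "real ((N - 1) div 2) \<noteq> 0" by linarith+
    then show ?case using split[of N] elim by (simp add: add_divide_distrib)
  qed
  ultimately have "(\<lambda>N. real (card {x. x \<le> N \<and> x \<in> S}) / real N) \<longlonglongrightarrow> L1 * (1/2) + L2 * (1/2)"
    by (rule Lim_transform_eventually)
  then show ?thesis by (simp add: has_density_def field_simps)
qed

lemma density_bound: "(\<lambda>N. real (N + 1) / real N) \<longlonglongrightarrow> 1"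
proof -
  have "(\<lambda>N. 1 + 1 / real N) \<longlonglongrightarrow> 1 + 0"
    by (intro tendsto_intros lim_1_over_n)
  moreover have "\<forall>\<^sub>F N in sequentially. 1 + 1 / real N = real (N + 1) / real N"
    using eventually_ge_at_top[of 1] by eventually_elim (simp add: field_simps)
  ultimately show ?thesis using Lim_transform_eventually by fastforce
qed

lemma diff_set_even:
  "{x. 2 * x \<in> diff_set (2 * b) d} = diff_set b d"
  "{x. Suc (2 * x) \<in> diff_set (2 * b) d} = diff_set b d"
proof -
  have "s2 (2 * x + 2 * b) = s2 (x + b)" for x
    using s2_double[of "x + b"] by simp
  moreover have "s2 (Suc (2 * x + 2 * b)) = Suc (s2 (x + b))" for x
    using s2_double_Suc[of "x + b"] by simp
  ultimately show "{x. 2 * x \<in> diff_set (2 * b) d} = diff_set b d"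
    "{x. Suc (2 * x) \<in> diff_set (2 * b) d} = diff_set b d"
    by (simp_all add: diff_set_def)
qed

lemma diff_set_odd:
  "{x. 2 * x \<in> diff_set (Suc (2 * b)) d} = diff_set b (d - 1)"
  "{x. Suc (2 * x) \<in> diff_set (Suc (2 * b)) d} = diff_set (Suc b) (d + 1)"
proof -
  have "s2 (Suc (Suc (2 * x + 2 * b))) = s2 (Suc (x + b))" for x
    using s2_double[of "Suc (x + b)"] by simp
  moreover have "s2 (Suc (2 * x + 2 * b)) = Suc (s2 (x + b))" for x
    using s2_double_Suc[of "x + b"] by simp
  ultimately show "{x. 2 * x \<in> diff_set (Suc (2 * b)) d} = diff_set b (d - 1)"
    "{x. Suc (2 * x) \<in> diff_set (Suc (2 * b)) d} = diff_set (Suc b) (d + 1)"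
    by (auto simp: diff_set_def)
qed

lemma has_density_empty: "has_density {} 0"
  by (simp add: has_density_def)

lemma diff_set_0_density: "\<exists>L. has_density (diff_set 0 d) L"
proof (cases "d = 0")
  case True
  have "{x. x \<le> N} = {..N}" for N :: nat by auto
  then have "has_density (diff_set 0 d) 1"
    using density_bound True by (simp add: has_density_def diff_set_def)
  then show ?thesis ..
next
  case False
  then have "diff_set 0 d = {}" by (auto simp: diff_set_def)
  then show ?thesis using has_density_empty by auto
qed

lemma diff_set_1_density: "\<exists>L. has_density (diff_set (Suc 0) d) L"
proof -
  have "\<exists>L. has_density (diff_set (Suc 0) (2 - int n)) L" for n
  proof (induction n)
    case 0
    have "int (s2 (Suc x)) - int (s2 x) \<noteq> 2" for x
      using s2_Suc_le[of x] by linarith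
    then have "diff_set (Suc 0) 2 = {}" by (auto simp: diff_set_def)
    then show ?case using has_density_empty by auto
  next
    case (Suc n)
    have "2 - int (Suc n) + 1 = 2 - int n" by simp
    then show ?case
      using has_density_split[of "diff_set (Suc 0) (2 - int (Suc n))"] Suc
        diff_set_odd[of 0 "2 - int (Suc n)"] diff_set_0_density[of "2 - int (Suc n) - 1"]
      by (metis mult_0_right)
  qed
  from this[of "nat (2 - d)"] show ?thesis
  proof (cases "d \<le> 2")
    case False
    then have "int (s2 (Suc x)) - int (s2 x) \<noteq> d" for x
      using s2_Suc_le[of x] by linarith
    then have "diff_set (Suc 0) d = {}" by (auto simp: diff_set_def)
    then show ?thesis using has_density_empty by auto
  qed simp
qed

lemma diff_set_density: "\<exists>L. has_density (diff_set a d) L"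
proof (induction a arbitrary: d rule: less_induct)
  case (less a)
  consider "a = 0" | "a = 1" | b where "a = 2 * b" "b > 0" | b where "a = Suc (2 * b)" "b > 0"
    by (metis One_nat_def Suc_eq_plus1 bot_nat_0.not_eq_extremum evenE mult_0_right oddE)
  then show ?case
  proof cases
    case 1 then show ?thesis using diff_set_0_density by simp
  next
    case 2 then show ?thesis using diff_set_1_density by simp
  next
    case (3 b)
    then obtain L where "has_density (diff_set b d) L" using less[of b] by auto
    then show ?thesis using has_density_split[of "diff_set a d" L L] 3 by (auto simp: diff_set_even)
  next
    case (4 b)
    then obtain L1 where "has_density (diff_set b (d - 1)) L1" using less[of b] by auto
    moreover obtain L2 where "has_density (diff_set (Suc b) (d + 1)) L2" using less[of "Suc b"] 4 by auto
    ultimately show ?thesis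
      using has_density_split[of "diff_set a d" L1 L2] 4 by (auto simp: diff_set_odd)
  qed
qed

lemma mu_tendsto:
  "(\<lambda>N. real (card {x. x \<le> N \<and> int (s2 (x + a)) - int (s2 x) = d}) / real N) \<longlonglongrightarrow> mu a d"
proof -
  have "convergent (\<lambda>N. real (card {x. x \<le> N \<and> int (s2 (x + a)) - int (s2 x) = d}) / real N)"
    using diff_set_density[of a d] by (auto simp: convergent_def has_density_def diff_set_def)
  then show ?thesis unfolding mu_def by (simp add: convergent_LIMSEQ_iff)
qed

lemma mu_nonneg: "0 \<le> mu a d"
  by (rule tendsto_lowerbound[OF mu_tendsto]) auto

lemma mu_sum_le_1:
  assumes "finite F"
  shows "(\<Sum>d\<in>F. mu a d) \<le> 1"
proof (rule tendsto_le[OF _ density_bound])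
  show "(\<lambda>N. \<Sum>d\<in>F. real (card {x. x \<le> N \<and> int (s2 (x + a)) - int (s2 x) = d}) / real N)
      \<longlonglongrightarrow> (\<Sum>d\<in>F. mu a d)"
    by (intro tendsto_sum mu_tendsto)
  have "(\<Sum>d\<in>F. real (card {x. x \<le> N \<and> int (s2 (x + a)) - int (s2 x) = d}) / real N)
      \<le> real (N + 1) / real N" for N
  proof -
    have "(\<Sum>d\<in>F. card {x. x \<le> N \<and> int (s2 (x + a)) - int (s2 x) = d})
        = card (\<Union>d\<in>F. {x. x \<le> N \<and> int (s2 (x + a)) - int (s2 x) = d})"
      using assms by (subst card_UN_disjoint) auto
    also have "\<dots> \<le> card {..N}" by (intro card_mono) auto
    finally have "(\<Sum>d\<in>F. real (card {x. x \<le> N \<and> int (s2 (x + a)) - int (s2 x) = d})) \<le> real (N + 1)"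
      by (simp flip: of_nat_sum)
    then show ?thesis by (simp add: divide_right_mono flip: sum_divide_distrib)
  qed
  then show "\<forall>\<^sub>F N in sequentially.
      (\<Sum>d\<in>F. real (card {x. x \<le> N \<and> int (s2 (x + a)) - int (s2 x) = d}) / real N)
      \<le> real (N + 1) / real N"
    by simp
qed simp

lemma mu_square_summable: "(\<lambda>d. (mu a d)\<^sup>2) summable_on UNIV"
proof (rule nonneg_bdd_above_summable_on)
  show "bdd_above (sum (\<lambda>d. (mu a d)\<^sup>2) ` {F. F \<subseteq> UNIV \<and> finite F})"
  proof (rule bdd_aboveI2)
    fix F :: "int set" assume "F \<in> {F. F \<subseteq> UNIV \<and> finite F}"
    have "(\<Sum>d\<in>F. (mu a d)\<^sup>2) \<le> (\<Sum>d\<in>F. mu a d)"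
    proof (rule sum_mono)
      fix d
      show "(mu a d)\<^sup>2 \<le> mu a d"
        using mu_nonneg[of a d] mu_sum_le_1[of "{d}" a]
        by (simp add: power2_eq_square mult_left_le)
    qed
    then show "(\<Sum>d\<in>F. (mu a d)\<^sup>2) \<le> 1"
      using mu_sum_le_1[of F a] \<open>F \<in> _\<close> by simp
  qed
qed simp

end

theory Submission
  imports Defs
begin

text \<open>
  The characteristic function \<open>f\<^sub>a\<close> of \<open>mu a\<close> satisfies \<open>f\<^bsub>2b\<^esub> = f\<^sub>b\<close> and
  \<open>f\<^bsub>2b+1\<^esub> = (z f\<^sub>b + z\<^sup>-\<^sup>1 f\<^bsub>b+1\<^esub>) / 2\<close> with \<open>z = cis t\<close>. Hence prepending digits to
  \<open>b\<close> never increases \<open>max \<bar>f\<^sub>b\<bar> \<bar>f\<^bsub>b+1\<^esub>\<bar>\<close>, and prepending three digits \<open>01x\<close> multiplies it by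
  at most \<open>\<kappa> = 1 - (1 - cos t) / 12\<close>, since \<open>\<bar>1/4 + z/2\<bar> < 3/4\<close> off \<open>t = 0\<close>. As such a block accounts
  for at most two occurrences of \<open>01\<close>, we get \<open>\<bar>f\<^sub>a\<bar>\<^sup>2 \<le> \<kappa> ^ l a \<le> 1 / (1 + l a * t\<^sup>2 / 216)\<close> on
  \<open>[-\<pi>, \<pi>]\<close>, and integrating with Parseval's identity gives \<open>\<parallel>mu a\<parallel>\<^sup>2 = O(l a powr (-1/2))\<close>.
\<close>

section \<open>Digit recurrences for \<open>mu\<close>\<close>

lemma mu_eqI: "has_density (diff_set a d) L \<Longrightarrow> mu a d = L"
  using mu_tendsto[of a d] LIMSEQ_unique by (auto simp: has_density_def diff_set_def)

lemma has_density_mu: "has_density (diff_set a d) (mu a d)"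
  using mu_tendsto[of a d] by (simp add: has_density_def diff_set_def)

lemma mu_double: "mu (2 * b) d = mu b d"
  by (rule mu_eqI)
    (use has_density_split[of "diff_set (2 * b) d" "mu b d" "mu b d"] has_density_mu[of b d]
      in \<open>simp add: diff_set_even\<close>)

text \<open>Adding \<open>2b + 1\<close> to an even number \<open>2x\<close> turns the lowest digit
  0 into 1 and adds \<open>b\<close> to \<open>x\<close>. Added to \<open>2x + 1\<close>, it turns
  the lowest digit 1 into 0 and carries, so that \<open>b + 1\<close> is added to \<open>x\<close>.
  This explains the shifts \<open>d - 1\<close> and \<open>d + 1\<close>.\<close>

lemma mu_double_Suc: "mu (Suc (2 * b)) d = (mu b (d - 1) + mu (Suc b) (d + 1)) / 2"
  by (rule mu_eqI, rule has_density_split) (simp_all add: diff_set_odd has_density_mu)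

lemma mu_summable: "mu a summable_on UNIV"
proof (rule nonneg_bdd_above_summable_on)
  show "bdd_above (sum (mu a) ` {F. F \<subseteq> UNIV \<and> finite F})"
    by (rule bdd_aboveI2[where M = 1]) (auto intro: mu_sum_le_1)
qed (simp add: mu_nonneg)

lemma infsum_mu_le_1: "infsum (mu a) UNIV \<le> 1"
  by (rule infsum_le_finite_sums[OF mu_summable]) (auto intro: mu_sum_le_1)

section \<open>Characteristic functions\<close>

definition mu_hat :: "nat \<Rightarrow> real \<Rightarrow> complex"
  where "mu_hat a t = (\<Sum>\<^sub>\<infinity>d\<in>UNIV. of_real (mu a d) * cis (of_int d * t))"

text \<open>The index set \<open>A\<close> is arbitrary because the series is later split into a
  finite part and its tail.\<close>

lemma mu_hat_abs_summable:
  "(\<lambda>d. norm (of_real (mu a d) * cis (of_int d * t))) summable_on A"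
  using summable_on_subset_banach[OF mu_summable, of A a] by (simp add: norm_mult mu_nonneg)

lemma mu_hat_summable:
  "(\<lambda>d. of_real (mu a d) * cis (of_int d * t)) summable_on A"
  using abs_summable_summable[OF mu_hat_abs_summable] .

lemma norm_mu_hat_le_1: "norm (mu_hat a t) \<le> 1"
proof -
  have "norm (mu_hat a t) \<le> infsum (mu a) UNIV"
    unfolding mu_hat_def
    using norm_infsum_bound[OF mu_hat_abs_summable[of a t UNIV]] by (simp add: norm_mult mu_nonneg)
  then show ?thesis using infsum_mu_le_1[of a] by simp
qed

lemma mu_hat_double: "mu_hat (2 * b) t = mu_hat b t"
  by (simp add: mu_hat_def mu_double)

lemma has_sum_mu_shift:
  "((\<lambda>d. of_real (mu a (d + k)) * cis (of_int d * t)) has_sum cis (- of_int k * t) * mu_hat a t) UNIV"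
proof -
  have "((\<lambda>d. of_real (mu a d) * cis (of_int d * t)) has_sum mu_hat a t) UNIV"
    unfolding mu_hat_def by (rule has_sum_infsum[OF mu_hat_summable])
  then have "((\<lambda>d. cis (- of_int k * t) * (of_real (mu a d) * cis (of_int d * t)))
      has_sum cis (- of_int k * t) * mu_hat a t) UNIV"
    by (rule has_sum_cmult_right)
  moreover have "bij_betw (\<lambda>d. d + k) UNIV (UNIV :: int set)"
    by (rule bij_betwI[of _ _ _ "\<lambda>d. d - k"]) auto
  ultimately have "((\<lambda>d. cis (- of_int k * t) * (of_real (mu a (d + k)) * cis (of_int (d + k) * t)))
      has_sum cis (- of_int k * t) * mu_hat a t) UNIV"
    by (subst has_sum_reindex_bij_betw)
  moreover have "cis (- of_int k * t) * (of_real (mu a (d + k)) * cis (of_int (d + k) * t))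
      = of_real (mu a (d + k)) * cis (of_int d * t)" for d
    by (simp add: cis_mult mult.left_commute algebra_simps)
  ultimately show ?thesis by (simp only:)
qed

lemma mu_hat_double_Suc:
  "mu_hat (Suc (2 * b)) t = (cis t * mu_hat b t + cis (- t) * mu_hat (Suc b) t) / 2"
proof -
  have "((\<lambda>d. (of_real (mu b (d + -1)) * cis (of_int d * t)
      + of_real (mu (Suc b) (d + 1)) * cis (of_int d * t)) * (1/2)) has_sum
      (cis (- of_int (-1) * t) * mu_hat b t + cis (- of_int 1 * t) * mu_hat (Suc b) t) * (1/2)) UNIV"
    by (intro has_sum_cmult_left has_sum_add has_sum_mu_shift)
  then have "((\<lambda>d. of_real (mu (Suc (2 * b)) d) * cis (of_int d * t)) has_sum
      (cis t * mu_hat b t + cis (- t) * mu_hat (Suc b) t) / 2) UNIV"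
    by (simp add: mu_double_Suc distrib_right add_divide_distrib)
  then show ?thesis unfolding mu_hat_def by (rule infsumI)
qed

section \<open>Contraction by blocks of digits\<close>

lemma norm_mu_hat_double_Suc_le:
  "norm (mu_hat (Suc (2 * b)) t) \<le> (norm (mu_hat b t) + norm (mu_hat (Suc b) t)) / 2"
  unfolding mu_hat_double_Suc
  using norm_triangle_ineq[of "cis t * mu_hat b t" "cis (- t) * mu_hat (Suc b) t"]
  by (simp add: norm_divide norm_mult)

text \<open>With \<open>u = 1 - cos t\<close>, the squared norm is exactly
  \<open>9/16 - u/4\<close>, and the square of the right side exceeds this by \<open>u^2/36\<close>.
  The constant 1/6 is the one for which the linear terms agree.\<close>

lemma norm_quarter_plus_half_cis:
  "norm (1/4 + cis t / 2) \<le> 3/4 - (1 - cos t) / 6"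
proof (rule power2_le_imp_le)
  have "(norm (1/4 + cis t / 2))\<^sup>2 = (1/4 + cos t / 2)\<^sup>2 + (sin t / 2)\<^sup>2"
    by (simp add: cmod_power2)
  also have "\<dots> = 9/16 - (1 - cos t) / 4"
    unfolding cos_squared_eq[of t] power2_sum power_divide by (simp add: field_simps cos_squared_eq)
  also have "\<dots> \<le> (3/4 - (1 - cos t) / 6)\<^sup>2"
    using zero_le_power2[of "(1 - cos t) / 6"] by (simp add: power2_eq_square field_simps)
  finally show "(norm (1/4 + cis t / 2))\<^sup>2 \<le> (3/4 - (1 - cos t) / 6)\<^sup>2" .
  show "0 \<le> 3/4 - (1 - cos t) / 6"
    using cos_ge_minus_one[of t] by (simp add: field_simps del: cos_ge_minus_one)
qed

text \<open>Unfolding the recurrence down to \<open>b\<close> gives three terms. Two of them meet at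
  the same function, \<open>mu_hat b\<close> or \<open>mu_hat (Suc b)\<close> according to the
  second digit, and their coefficients 1/4 and \<open>cis t / 2\<close> (or
  \<open>cis (- t) / 2\<close>) partly cancel when \<open>cis t\<close> is not 1. The third has a
  coefficient of modulus 1/4.\<close>

lemma norm_mu_hat_two_digits:
  assumes M: "norm (mu_hat b t) \<le> M" "norm (mu_hat (Suc b) t) \<le> M" and c: "c = 2 * b \<or> c = Suc (2 * b)"
  shows "norm (mu_hat (Suc (2 * c)) t) \<le> (1 - (1 - cos t) / 6) * M"
proof -
  let ?z = "cis t" and ?u = "cis (- t)"
  have zu: "?u * ?z = 1" by (simp add: cis_mult)
  have bound: "norm (p * x + w * y) \<le> (1 - (1 - cos t) / 6) * M"
    if "norm p \<le> 3/4 - (1 - cos t) / 6" "norm w \<le> 1/4" "norm x \<le> M" "norm y \<le> M" for p w x y :: complex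
  proof -
    have "norm (p * x + w * y) \<le> norm p * norm x + norm w * norm y"
      using norm_triangle_ineq[of "p * x" "w * y"] by (simp add: norm_mult)
    also have "\<dots> \<le> (3/4 - (1 - cos t) / 6) * M + 1/4 * M"
      using that by (intro add_mono mult_mono order_trans[OF norm_ge_zero]) auto
    also have "\<dots> = (1 - (1 - cos t) / 6) * M" by (simp add: field_simps)
    finally show ?thesis .
  qed
  show ?thesis
  proof (cases "c = 2 * b")
    case True
    have "mu_hat (Suc (2 * c)) t = (?u * ?z / 4 + ?z / 2) * mu_hat b t + (?u\<^sup>2 / 4) * mu_hat (Suc b) t"
      unfolding mu_hat_double_Suc True mu_hat_double
        by (simp add: power2_eq_square ring_distribs add_divide_distrib mult_ac)
    then have "mu_hat (Suc (2 * c)) t = (1/4 + ?z / 2) * mu_hat b t + (?u\<^sup>2 / 4) * mu_hat (Suc b) t"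
      unfolding zu .
    then show ?thesis
      using bound[OF norm_quarter_plus_half_cis[of t] _ M(1) M(2), of "?u\<^sup>2 / 4"]
      by (simp add: norm_divide norm_power)
  next
    case False
    then have c': "c = Suc (2 * b)" "Suc c = 2 * Suc b" using c by auto
    have "mu_hat (Suc (2 * c)) t = (?z * mu_hat c t + ?u * mu_hat (Suc b) t) / 2"
      unfolding mu_hat_double_Suc[of c] c'(2) mu_hat_double ..
    also have "\<dots> = (?u * ?z / 4 + ?u / 2) * mu_hat (Suc b) t + (?z\<^sup>2 / 4) * mu_hat b t"
      unfolding c'(1) mu_hat_double_Suc by (simp add: power2_eq_square ring_distribs add_divide_distrib mult_ac)
    finally have "mu_hat (Suc (2 * c)) t = (1/4 + ?u / 2) * mu_hat (Suc b) t + (?z\<^sup>2 / 4) * mu_hat b t"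
      unfolding zu .
    then show ?thesis
      using bound[OF norm_quarter_plus_half_cis[of "- t", unfolded cos_minus] _ M(2) M(1), of "?z\<^sup>2 / 4"]
      by (simp add: norm_divide norm_power)
  qed
qed

text \<open>Both \<open>c\<close> and \<open>Suc c\<close> are among \<open>2b\<close>,
  \<open>2b + 1\<close>, \<open>2b + 2\<close>; the outer two reproduce \<open>mu_hat b\<close> and
  \<open>mu_hat (Suc b)\<close>, and the middle one is their mean up to unimodular factors.\<close>

lemma norm_mu_hat_one_digit:
  assumes M: "norm (mu_hat b t) \<le> M" "norm (mu_hat (Suc b) t) \<le> M" and c: "c = 2 * b \<or> c = Suc (2 * b)"
  shows "norm (mu_hat c t) \<le> M" "norm (mu_hat (Suc c) t) \<le> M"
proof -
  have "norm (mu_hat (Suc (2 * b)) t) \<le> M"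
    using norm_mu_hat_double_Suc_le[of b t] M by simp
  then show "norm (mu_hat c t) \<le> M" "norm (mu_hat (Suc c) t) \<le> M"
    using c M mu_hat_double[of b t] mu_hat_double[of "Suc b" t] by auto
qed

text \<open>The two-digit gain reaches \<open>2c + 1\<close> but not its successor. The digit 0 in
  front repairs this: \<open>a\<close> inherits \<open>mu_hat (2c + 1)\<close>, and
  \<open>Suc a\<close> averages it with \<open>mu_hat (2c + 2)\<close>, so both keep at least half
  of the gain, whence 1/12.\<close>

lemma norm_mu_hat_three_digits:
  assumes M: "norm (mu_hat b t) \<le> M" "norm (mu_hat (Suc b) t) \<le> M" and c: "c = 2 * b \<or> c = Suc (2 * b)"
    and a: "a = 2 * Suc (2 * c)"
  shows "norm (mu_hat a t) \<le> (1 - (1 - cos t) / 12) * M"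
    "norm (mu_hat (Suc a) t) \<le> (1 - (1 - cos t) / 12) * M"
proof -
  have M0: "0 \<le> M" using M(1) norm_ge_zero order_trans by blast
  have U: "norm (mu_hat (Suc (2 * c)) t) \<le> (1 - (1 - cos t) / 6) * M"
    by (rule norm_mu_hat_two_digits[OF M c])
  have V: "norm (mu_hat (Suc (Suc (2 * c))) t) \<le> M"
    by (rule norm_mu_hat_one_digit(2)[OF norm_mu_hat_one_digit[OF M c]]) simp
  have "(1 - (1 - cos t) / 6) * M \<le> (1 - (1 - cos t) / 12) * M"
    using M0 cos_le_one[of t] by (intro mult_right_mono) auto
  then show "norm (mu_hat a t) \<le> (1 - (1 - cos t) / 12) * M"
    unfolding a mu_hat_double using U by simp
  have "norm (mu_hat (Suc a) t) \<le> ((1 - (1 - cos t) / 6) * M + M) / 2"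
    unfolding a using norm_mu_hat_double_Suc_le[of "Suc (2 * c)" t] U V by simp
  then show "norm (mu_hat (Suc a) t) \<le> (1 - (1 - cos t) / 12) * M"
    by (simp add: algebra_simps)
qed

section \<open>Decay in the number of occurrences of 01\<close>

lemma l_rec: "l a = (if even a \<and> odd (a div 2) then 1 else 0) + l (a div 2)"
proof -
  let ?S = "\<lambda>a::nat. {i. \<not> bit a i \<and> bit a (i + 1)}"
  have S: "?S a = (if even a \<and> odd (a div 2) then {0} else {}) \<union> Suc ` ?S (a div 2)"
  proof (intro set_eqI)
    fix i show "i \<in> ?S a \<longleftrightarrow>
        i \<in> (if even a \<and> odd (a div 2) then {0} else {}) \<union> Suc ` ?S (a div 2)"
      by (cases i) (auto simp: bit_Suc bit_0)
  qed
  have "finite (?S (a div 2))"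
    by (rule finite_subset[OF _ finite_imageI[OF finite_bits[of "a div 2"], of "\<lambda>i. i - 1"]]) force
  then show ?thesis
    unfolding l_def S by (subst card_Un_disjoint) (auto simp: card_image)
qed

text \<open>The induction strips three digits when the word starts with 01 and one digit otherwise.
  It must carry \<open>a\<close> and \<open>Suc a\<close> together, since the recurrence mixes them;
  both bounds use the exponent \<open>l a\<close>. The square root spreads the gain of a block over
  its two possible occurrences.\<close>

lemma norm_mu_hat_le_power:
  "norm (mu_hat a t) \<le> sqrt (1 - (1 - cos t) / 12) ^ l a \<and>
   norm (mu_hat (Suc a) t) \<le> sqrt (1 - (1 - cos t) / 12) ^ l a"
proof (induction a rule: less_induct)
  case (less a)
  let ?s = "sqrt (1 - (1 - cos t) / 12)"
  have s: "0 \<le> ?s" "?s \<le> 1" "?s\<^sup>2 = 1 - (1 - cos t) / 12"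
    using cos_ge_minus_one[of t] cos_le_one[of t] by (auto simp: field_simps simp del: cos_ge_minus_one)
  consider "a = 0" | "a > 0" "even a" "odd (a div 2)" | "a > 0" "\<not> (even a \<and> odd (a div 2))" by blast
  then show ?case
  proof cases
    case 1
    have "l 0 = 0" by (simp add: l_def)
    then show ?thesis using 1 norm_mu_hat_le_1 by simp
  next
    case 2
    define c where "c = a div 4"
    define b where "b = c div 2"
    have c: "c = 2 * b \<or> c = Suc (2 * b)" unfolding b_def by presburger
    have a: "a = 2 * Suc (2 * c)" unfolding c_def using 2 by presburger
    have "b < a" using c a by auto
    \<comment> \<open>The leading 01 counts once, the digit 1 starts no occurrence, and the third
      digit starts one only if it is 0 and \<open>b\<close> is odd.\<close>
    have "l a = 1 + l (Suc (2 * c))" using l_rec[of a] a by simp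
    also have "l (Suc (2 * c)) = l c" using l_rec[of "Suc (2 * c)"] by simp
    also have "l c \<le> 1 + l b" using l_rec[of c] by (simp add: b_def)
    finally have "l a \<le> l b + 2" by simp
    then have "(1 - (1 - cos t) / 12) * ?s ^ l b \<le> ?s ^ l a"
      using power_decreasing[OF _ s(1,2), of "l a" "l b + 2"] 
      unfolding power_add s(3) by (simp only: mult.commute)
    then show ?thesis
      using norm_mu_hat_three_digits[OF conjunct1 conjunct2 c a, OF less less] \<open>b < a\<close>
      by (meson order_trans)
  next
    case 3
    then have "l a = l (a div 2)" using l_rec[of a] by auto
    moreover have "a = 2 * (a div 2) \<or> a = Suc (2 * (a div 2))" by presburger
    moreover have "a div 2 < a" using 3 by simp
    ultimately show ?thesis
      using norm_mu_hat_one_digit[OF conjunct1 conjunct2, OF less less, of "a div 2" a] by simp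
  qed
qed

section \<open>A rational bound on one period\<close>

lemma one_minus_cos_ge:
  fixes t :: real
  assumes "\<bar>t\<bar> \<le> pi"
  shows "t\<^sup>2 / 18 \<le> 1 - cos t"
proof -
  \<comment> \<open>For \<open>x = t / 2\<close> this yields
    \<open>1 - cos t = 2 * (sin x)^2 >= 2 * (t/6)^2\<close>, hence the 18. The factor 1/3 is what
    the cubic Taylor error leaves when the absolute value of \<open>x\<close> is at most 2.\<close>
  have "\<bar>x\<bar> / 3 \<le> \<bar>sin x\<bar>" if "\<bar>x\<bar> \<le> pi / 2" for x :: real
  proof -
    have "\<bar>x\<bar> \<le> 2" using that pi_less_4 by simp
    then have "\<bar>x\<bar>\<^sup>2 \<le> 2\<^sup>2" by (rule power_mono) simp
    then have "x\<^sup>2 * \<bar>x\<bar> \<le> 4 * \<bar>x\<bar>" by (intro mult_right_mono) auto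
    moreover have "\<bar>sin x - x\<bar> \<le> x\<^sup>2 * \<bar>x\<bar> / 6"
      using Maclaurin_sin_bound[of x 3]
      by (simp add: sin_coeff_def numeral_eq_Suc power2_eq_square abs_mult)
    ultimately show ?thesis by linarith
  qed
  from this[of "t / 2"] have "\<bar>t\<bar> / 6 \<le> \<bar>sin (t / 2)\<bar>" using assms by simp
  then have "(\<bar>t\<bar> / 6)\<^sup>2 \<le> \<bar>sin (t / 2)\<bar>\<^sup>2" by (rule power_mono) simp
  then show ?thesis using cos_double_sin[of "t / 2"] by (simp add: power2_eq_square)
qed

text \<open>The constant is 216 = 12 * 18. The estimate \<open>1 - x <= 1 / (1 + x)\<close> and
  Bernoulli's inequality trade the power for a rational function of \<open>t\<close> with an
  arctangent as antiderivative.\<close>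

lemma norm_mu_hat_sq_le:
  assumes "\<bar>t\<bar> \<le> pi"
  shows "(norm (mu_hat a t))\<^sup>2 \<le> 1 / (1 + real (l a) * t\<^sup>2 / 216)"
proof -
  let ?k = "1 - (1 - cos t) / 12" and ?x = "t\<^sup>2 / 216"
  have k0: "0 \<le> ?k" using cos_ge_minus_one[of t] by (simp add: field_simps del: cos_ge_minus_one)
  have "(norm (mu_hat a t))\<^sup>2 \<le> (sqrt ?k ^ l a)\<^sup>2"
    using norm_mu_hat_le_power[of a t] by (intro power_mono) auto
  also have "\<dots> = ?k ^ l a"
    using k0 by (simp add: power_mult[symmetric] mult.commute[of _ 2]) (simp add: power_mult)
  also have "\<dots> \<le> (1 - ?x) ^ l a"
    using one_minus_cos_ge[OF assms] k0 by (intro power_mono) auto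
  also have "\<dots> \<le> (1 / (1 + ?x)) ^ l a"
  proof (rule power_mono)
    have "(1 - ?x) * (1 + ?x) \<le> 1" by (simp add: algebra_simps)
    moreover have "0 < 1 + ?x" by (simp add: add_pos_nonneg)
    ultimately show "1 - ?x \<le> 1 / (1 + ?x)" by (simp add: pos_le_divide_eq)
    show "0 \<le> 1 - ?x" using one_minus_cos_ge[OF assms] k0 by simp
  qed
  also have "\<dots> = 1 / (1 + ?x) ^ l a" by (simp add: power_one_over)
  also have "\<dots> \<le> 1 / (1 + real (l a) * ?x)"
  proof (rule divide_left_mono)
    show "1 + real (l a) * ?x \<le> (1 + ?x) ^ l a"
      by (rule Bernoulli_inequality) (simp add: order_trans[of _ 0])
    show "0 < (1 + ?x) ^ l a * (1 + real (l a) * ?x)"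
      by (intro mult_pos_pos zero_less_power) (auto simp: add_pos_nonneg)
  qed simp
  finally show ?thesis by simp
qed

section \<open>Parseval's identity and the square sum\<close>

lemma has_integral_cos_int:
  "((\<lambda>t. cos (of_int k * t)) has_integral (if k = 0 then 2 * pi else 0)) {- pi..pi}"
proof (cases "k = 0")
  case True
  then show ?thesis using has_integral_const_real[of "1::real" "- pi" pi] by simp
next
  case False
  have "((\<lambda>t. cos (of_int k * t)) has_integral
      sin (of_int k * pi) / of_int k - sin (of_int k * - pi) / of_int k) {- pi..pi}"
  proof (rule fundamental_theorem_of_calculus)
    show "((\<lambda>t. sin (of_int k * t) / of_int k) has_vector_derivative cos (of_int k * t))
        (at t within {- pi..pi})" for t :: real
      unfolding has_real_derivative_iff_has_vector_derivative[symmetric]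
      using False by (auto intro!: derivative_eq_intros)
  qed simp
  then show ?thesis using False by (simp add: mult.commute[of _ pi])
qed

text \<open>Since the coefficients are real, the squared norm is a double sum of cosines of
  \<open>(d - e) * t\<close>, and integration keeps only its diagonal. With \<open>F\<close> finite,
  no limit is exchanged with the integral.\<close>

lemma parseval_trig_polynomial:
  fixes c :: "int \<Rightarrow> real"
  assumes "finite F"
  shows "((\<lambda>t. (norm (\<Sum>d\<in>F. of_real (c d) * cis (of_int d * t)))\<^sup>2) has_integral
    2 * pi * (\<Sum>d\<in>F. (c d)\<^sup>2)) {- pi..pi}"
proof -
  have eq: "(norm (\<Sum>d\<in>F. of_real (c d) * cis (of_int d * t)))\<^sup>2
      = (\<Sum>d\<in>F. \<Sum>e\<in>F. c d * c e * cos (of_int (d - e) * t))" for t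
  proof -
    have "(norm (\<Sum>d\<in>F. of_real (c d) * cis (of_int d * t)))\<^sup>2
        = (\<Sum>d\<in>F. c d * cos (of_int d * t))\<^sup>2 + (\<Sum>d\<in>F. c d * sin (of_int d * t))\<^sup>2"
      by (simp add: cmod_power2)
    then show ?thesis
      by (simp add: power2_eq_square sum_product sum.distrib[symmetric] left_diff_distrib cos_diff algebra_simps)
  qed
  have "((\<lambda>t. \<Sum>d\<in>F. \<Sum>e\<in>F. c d * c e * cos (of_int (d - e) * t)) has_integral
      (\<Sum>d\<in>F. \<Sum>e\<in>F. c d * c e * (if d - e = 0 then 2 * pi else 0))) {- pi..pi}"
    by (intro has_integral_sum assms has_integral_mult_right has_integral_cos_int)
  also have "(\<Sum>d\<in>F. \<Sum>e\<in>F. c d * c e * (if d - e = 0 then 2 * pi else 0))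
      = (\<Sum>d\<in>F. c d * c d * (2 * pi))"
    using assms by (intro sum.cong refl) (simp add: if_distrib cong: if_cong)
  also have "\<dots> = 2 * pi * (\<Sum>d\<in>F. (c d)\<^sup>2)"
    by (simp add: sum_distrib_left power2_eq_square mult_ac)
  finally show ?thesis unfolding eq .
qed

lemma has_integral_inverse_quadratic:
  fixes c :: real
  assumes "c > 0"
  shows "((\<lambda>t. 1 / (1 + c\<^sup>2 * t\<^sup>2)) has_integral 2 * arctan (c * pi) / c) {- pi..pi}"
proof -
  have "((\<lambda>t. 1 / (1 + c\<^sup>2 * t\<^sup>2)) has_integral arctan (c * pi) / c - arctan (c * - pi) / c) {- pi..pi}"
  proof (rule fundamental_theorem_of_calculus)
    show "((\<lambda>t. arctan (c * t) / c) has_vector_derivative 1 / (1 + c\<^sup>2 * t\<^sup>2)) (at t within {- pi..pi})"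
      for t :: real
      unfolding has_real_derivative_iff_has_vector_derivative[symmetric]
      using assms by (auto intro!: derivative_eq_intros simp: power_mult_distrib inverse_eq_divide)
  qed simp
  then show ?thesis by (simp add: arctan_minus)
qed

text \<open>Outside a large finite set \<open>G\<close> the mass of \<open>mu a\<close> is at most
  \<open>e\<close>, so the trigonometric polynomial over \<open>G\<close> is within \<open>e\<close>
  of \<open>mu_hat a\<close>, uniformly in \<open>t\<close>. Parseval's identity applies to this
  polynomial.\<close>

lemma sum_mu_sq_le:
  assumes "finite F" and l: "l a \<ge> 1" and e: "0 < e" "e \<le> 1"
  shows "(\<Sum>d\<in>F. (mu a d)\<^sup>2) \<le> sqrt 54 / sqrt (real (l a)) + 3 * e"
proof -
  have "(mu a has_sum infsum (mu a) UNIV) UNIV" by (rule has_sum_infsum[OF mu_summable])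
  from has_sum_finite_approximation[OF this e(1)]
  obtain F0 where F0: "finite F0" "dist (sum (mu a) F0) (infsum (mu a) UNIV) \<le> e" by blast
  \<comment> \<open>\<open>F0\<close> makes the tail small; \<open>F\<close> lets the square sum
    over \<open>G\<close> dominate the one over \<open>F\<close>.\<close>
  define G where "G = F \<union> F0"
  have G: "finite G" "F \<subseteq> G" using F0(1) assms(1) by (auto simp: G_def)
  let ?g = "\<lambda>d t. of_real (mu a d) * cis (of_int d * t)"
  have tail: "infsum (mu a) (- G) \<le> e"
  proof -
    have "infsum (mu a) UNIV = infsum (mu a) G + infsum (mu a) (- G)"
      by (subst infsum_Un_disjoint[symmetric])
        (auto intro: summable_on_subset_banach[OF mu_summable])
    moreover have "sum (mu a) F0 \<le> sum (mu a) G"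
      using G(1) by (intro sum_mono2) (auto simp: G_def mu_nonneg)
    ultimately show ?thesis using F0(2) G(1) by (simp add: dist_real_def)
  qed
  have le: "(norm (\<Sum>d\<in>G. ?g d t))\<^sup>2 \<le> 1 / (1 + (sqrt (real (l a) / 216))\<^sup>2 * t\<^sup>2) + 3 * e"
    if "t \<in> {- pi..pi}" for t
  proof -
    have "mu_hat a t = infsum (\<lambda>d. ?g d t) G + infsum (\<lambda>d. ?g d t) (- G)"
      unfolding mu_hat_def
      by (subst infsum_Un_disjoint[symmetric]) (auto intro: mu_hat_summable)
    then have "(\<Sum>d\<in>G. ?g d t) = mu_hat a t - infsum (\<lambda>d. ?g d t) (- G)" using G(1) by simp
    moreover have "norm (infsum (\<lambda>d. ?g d t) (- G)) \<le> e"
      using norm_infsum_bound[OF mu_hat_abs_summable[of a t "- G"]] tail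
      by (simp add: norm_mult mu_nonneg)
    ultimately have "norm (\<Sum>d\<in>G. ?g d t) \<le> norm (mu_hat a t) + e"
      using norm_triangle_ineq4[of "mu_hat a t" "infsum (\<lambda>d. ?g d t) (- G)"] by simp
    then have "(norm (\<Sum>d\<in>G. ?g d t))\<^sup>2 \<le> (norm (mu_hat a t) + e)\<^sup>2"
      by (intro power_mono) auto
    also have "\<dots> = (norm (mu_hat a t))\<^sup>2 + (2 * norm (mu_hat a t) + e) * e"
      by (simp add: power2_eq_square algebra_simps)
    \<comment> \<open>As \<open>e\<close> and the norm of \<open>mu_hat a t\<close> are at most 1,
      the factor of \<open>e\<close> is at most 3.\<close>
    also have "\<dots> \<le> 1 / (1 + real (l a) * t\<^sup>2 / 216) + 3 * e"
      using e norm_mu_hat_le_1[of a t] that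
      by (intro add_mono mult_right_mono norm_mu_hat_sq_le) auto
    finally show ?thesis by simp
  qed
  define c where "c = sqrt (real (l a) / 216)"
  have c: "c > 0" using l by (simp add: c_def)
  have "((\<lambda>t. 1 / (1 + c\<^sup>2 * t\<^sup>2) + 3 * e) has_integral 2 * arctan (c * pi) / c + 2 * pi * (3 * e)) {- pi..pi}"
    using has_integral_add[OF has_integral_inverse_quadratic[OF c] has_integral_const_real[of "3 * e" "- pi" pi]]
    by simp
  then have "2 * pi * (\<Sum>d\<in>G. (mu a d)\<^sup>2) \<le> 2 * arctan (c * pi) / c + 2 * pi * (3 * e)"
    using le by (intro has_integral_le[OF parseval_trig_polynomial[OF G(1)]]) (auto simp: c_def)
  \<comment> \<open>Bounding the arctangent by \<open>pi / 2\<close> leaves a main term of order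
    \<open>1 / c\<close>, that is, \<open>l a\<close> to the power -1/2.\<close>
  also have "\<dots> \<le> 2 * (pi / 2) / c + 2 * pi * (3 * e)"
    using arctan_ubound[of "c * pi"] c by (intro add_right_mono divide_right_mono) auto
  also have "\<dots> = 2 * pi * (1 / (2 * c) + 3 * e)" using c by (simp add: field_simps)
  finally have "(\<Sum>d\<in>G. (mu a d)\<^sup>2) \<le> 1 / (2 * c) + 3 * e" by simp
  moreover have "1 / (2 * c) = sqrt 54 / sqrt (real (l a))"
  proof -
    have "sqrt 216 = 2 * sqrt (54::real)" using real_sqrt_mult[of 4 54] by simp
    then show ?thesis by (simp add: c_def real_sqrt_divide)
  qed
  moreover have "(\<Sum>d\<in>F. (mu a d)\<^sup>2) \<le> (\<Sum>d\<in>G. (mu a d)\<^sup>2)"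
    using G by (intro sum_mono2) auto
  ultimately show ?thesis by simp
qed

theorem theorem2:
  shows "\<exists>C\<^sub>0::real. \<forall>a::nat. a > 0 \<and> l a \<ge> 1 \<longrightarrow>
    l2_norm (mu a) \<le> C\<^sub>0 * real (l a) powr (- 1 / 4)"
proof (intro exI allI impI)
  fix a :: nat
  assume "a > 0 \<and> l a \<ge> 1"
  then have l: "l a \<ge> 1" by simp
  let ?B = "sqrt 54 / sqrt (real (l a))"
  have "(\<Sum>d\<in>F. (mu a d)\<^sup>2) \<le> ?B" if "finite F" for F
  proof (rule field_le_epsilon)
    fix e :: real assume "0 < e"
    then show "(\<Sum>d\<in>F. (mu a d)\<^sup>2) \<le> ?B + e"
      \<comment> \<open>The error term is three times the parameter, hence \<open>e / 3\<close>; the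
        cap 1 meets the upper bound on the parameter.\<close>
      using sum_mu_sq_le[OF that l, of "min 1 (e / 3)"] by simp
  qed
  then have "(\<Sum>\<^sub>\<infinity>d\<in>UNIV. (mu a d)\<^sup>2) \<le> ?B"
    by (intro infsum_le_finite_sums mu_square_summable)
  then have "l2_norm (mu a) \<le> sqrt ?B" unfolding l2_norm_def by (rule real_sqrt_le_mono)
  also have "\<dots> = sqrt (sqrt 54) * real (l a) powr (- 1 / 4)"
  proof -
    have "sqrt (sqrt (real (l a))) = (real (l a) powr (1/2)) powr (1/2)" by (simp add: powr_half_sqrt)
    also have "\<dots> = real (l a) powr (1/4)" by (simp only: powr_powr) simp
    finally have "sqrt ?B = sqrt (sqrt 54) / real (l a) powr (1/4)" by (simp only: real_sqrt_divide)
    then show ?thesis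
      unfolding divide_inverse powr_minus[symmetric] by (simp only: mult_minus_left mult_1_left)
  qed
  finally show "l2_norm (mu a) \<le> sqrt (sqrt 54) * real (l a) powr (- 1 / 4)" .
qed

end
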